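(* Let $n,m\in\mathbb{N}$, let $\Omega_1,\Omega_2\subseteq\mathbb{R}^n$ be nonempty open sets, and let $f:\Omega_1\cup\Omega_2\cup(\Omega_1+\Omega_2)\to\mathbb{R}^m$ be a Fréchet differentiable function such that $f(\Omega_1)$ and $f(\Omega_2)$ are open. Assume that there exists a Fréchet differentiable function $g:f(\Omega_1)\times f(\Omega_2)\to\mathbb{R}^m$ such that $$f(x+y)=g(f(x),f(y))\qquad((x,y)\in\Omega_1\times\Omega_2).$$ Let $d:\mathbb{R}\to\mathbb{R}$ be an additive function which is a derivation with respect to $f$. Then $d$ is also a derivation with respect to $g$ on $f(\Omega_1)\times f(\Omega_2)$.
   Context: A function $d:\mathbb{R}\to\mathbb{R}$ is additive if $d(x+y)=d(x)+d(y)$ for all $x,y\in\mathbb{R}$. For a Fréchet differentiable function $h:\Omega\to\mathbb{R}^q$ on a nonempty open set $\Omega\subseteq\mathbb{R}^p$, a function $d:\mathbb{R}\to\mathbb{R}$ is called a derivation with respect to $h$ (on $\Omega$) if for all $x\in\Omega$ and all $j\in\{1,\dots,q\}$, $$d(h_j(x))=\partial_1 h_j(x)\,d(x_1)+\dots+\partial_p h_j(x)\,d(x_p),$$ where $x_i$ is the $i$th coordinate of $x$ and $h_j$ the $j$th coordinate function of $h$. Here $f(\Omega_1)\times f(\Omega_2)$ is regarded as a subset of $\mathbb{R}^{2m}$. *)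

theory Defs
  imports "HOL-Analysis.Analysis"
begin

text \<open>
  Coordinates are taken with respect to the standard basis \<^const>\<open>Basis\<close> of a Euclidean space,
  so the same definitions serve for \<open>real ^ 'n\<close> (basis vectors \<open>axis i 1\<close>) and for
  \<open>(real ^ 'm) \<times> (real ^ 'm)\<close> as a model of the real coordinate space of dimension \<open>2 * CARD('m)\<close>
  (basis vectors \<open>(axis i 1, 0)\<close> and \<open>(0, axis i 1)\<close>).
\<close>

definition partial_deriv :: "'a::euclidean_space \<Rightarrow> ('a \<Rightarrow> real) \<Rightarrow> 'a \<Rightarrow> real" where
  "partial_deriv i h x = deriv (\<lambda>t::real. h (x + t *\<^sub>R i)) 0"

text \<open>
  Meant for \<open>h\<close> differentiable on a nonempty open set \<open>\<Omega>\<close>; these requirements are not part of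
  the predicate.
\<close>

definition derivation_wrt ::
    "(real \<Rightarrow> real) \<Rightarrow> ('a::euclidean_space \<Rightarrow> 'b::euclidean_space) \<Rightarrow> 'a set \<Rightarrow> bool" where
  "derivation_wrt d h \<Omega> \<longleftrightarrow>
    (\<forall>x\<in>\<Omega>. \<forall>j\<in>Basis.
      d (h x \<bullet> j) = (\<Sum>i\<in>Basis. partial_deriv i (\<lambda>z. h z \<bullet> j) x * d (x \<bullet> i)))"

end

theory Submission
  imports Defs
begin

text \<open>
  Write \<open>D z\<close> for the vector obtained by applying \<open>d\<close> to every coordinate of \<open>z\<close>. For
  differentiable \<open>h\<close>, being a derivation with respect to \<open>h\<close> means \<open>D (h x) = h' x (D x)\<close>
  with the Frechet derivative \<open>h' x\<close> (lemma \<open>derivation_wrt_iff_coordwise\<close>).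
  In this form the result is the chain rule. Differentiating \<open>f (x + y) = g (f x, f y)\<close> in
  \<open>(x, y)\<close> in the direction \<open>(D x, D y)\<close> gives
  \<open>f' (x + y) (D x + D y) = g' (f x, f y) (f' x (D x), f' y (D y))\<close>. Since \<open>d\<close> is additive and a
  derivation with respect to \<open>f\<close> at the three points \<open>x\<close>, \<open>y\<close> and \<open>x + y\<close>, this reads
  \<open>D (f (x + y)) = g' (f x, f y) (D (f x), D (f y))\<close>, which is the derivation property of \<open>g\<close> at
  \<open>(f x, f y)\<close>.
\<close>

definition coordwise :: "(real \<Rightarrow> real) \<Rightarrow> 'a::euclidean_space \<Rightarrow> 'a" where
  "coordwise d z = (\<Sum>i\<in>Basis. d (z \<bullet> i) *\<^sub>R i)"

lemma coordwise_inner_Basis: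
  assumes "j \<in> Basis"
  shows "coordwise d z \<bullet> j = d (z \<bullet> j)"
  using assms unfolding coordwise_def by simp

lemma coordwise_add:
  assumes "Modules.additive d"
  shows "coordwise d (x + y) = coordwise d x + coordwise d y"
  by (simp add: coordwise_def inner_add_left additive.add[OF assms] scaleR_add_left sum.distrib)

text \<open>
  Every basis vector of a product lies in one of the two factors, so no coordinate of \<open>(u, v)\<close>
  mixes \<open>u\<close> with \<open>v\<close>.
\<close>

lemma coordwise_Pair: "coordwise d (u, v) = (coordwise d u, coordwise d v)"
proof (rule euclidean_eqI)
  fix b :: "'a \<times> 'b"
  assume b: "b \<in> Basis"
  then consider i where "i \<in> Basis" "b = (i, 0)" | j where "j \<in> Basis" "b = (0, j)"
    by (auto simp: Basis_prod_def)
  then show "coordwise d (u, v) \<bullet> b = (coordwise d u, coordwise d v) \<bullet> b"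
    by cases (use b in \<open>simp_all add: coordwise_inner_Basis\<close>)
qed

lemma partial_deriv_eq_derivative:
  assumes "(h has_derivative h') (at x)"
  shows "partial_deriv i (\<lambda>z. h z \<bullet> j) x = h' i \<bullet> j"
proof -
  have "((\<lambda>t. h (x + t *\<^sub>R i) \<bullet> j) has_derivative (\<lambda>t. h' (t *\<^sub>R i) \<bullet> j)) (at 0)"
  proof (rule has_derivative_inner_left)
    have "((\<lambda>t. x + t *\<^sub>R i) has_derivative (\<lambda>t. t *\<^sub>R i)) (at 0)"
      by (auto intro!: derivative_eq_intros)
    moreover have "(h has_derivative h') (at (x + 0 *\<^sub>R i))"
      using assms by simp
    ultimately show "((\<lambda>t. h (x + t *\<^sub>R i)) has_derivative (\<lambda>t. h' (t *\<^sub>R i))) (at 0)"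
      by (rule has_derivative_compose)
  qed
  moreover have "(\<lambda>t. h' (t *\<^sub>R i) \<bullet> j) = (*) (h' i \<bullet> j)"
    using assms by (auto simp: fun_eq_iff has_derivative_def linear_simps)
  ultimately have "((\<lambda>t. h (x + t *\<^sub>R i) \<bullet> j) has_field_derivative h' i \<bullet> j) (at 0)"
    by (simp add: has_field_derivative_def)
  then show ?thesis
    by (simp add: partial_deriv_def DERIV_imp_deriv)
qed

text \<open>
  The sum of partial derivatives in the definition of a derivation is the matrix of the Frechet
  derivative applied to the vector with coordinates \<open>d (x \<bullet> i)\<close>.
\<close>

lemma derivation_wrt_iff_coordwise:
  assumes "\<And>x. x \<in> \<Omega> \<Longrightarrow> (h has_derivative h' x) (at x)"
  shows "derivation_wrt d h \<Omega> \<longleftrightarrow> (\<forall>x\<in>\<Omega>. coordwise d (h x) = h' x (coordwise d x))"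
proof -
  have "(\<Sum>i\<in>Basis. partial_deriv i (\<lambda>z. h z \<bullet> j) x * d (x \<bullet> i)) = h' x (coordwise d x) \<bullet> j"
    if "x \<in> \<Omega>" for x j
  proof -
    have "linear (h' x)"
      using assms[OF that] has_derivative_linear by blast
    then have "h' x (coordwise d x) = (\<Sum>i\<in>Basis. d (x \<bullet> i) *\<^sub>R h' x i)"
      by (simp add: coordwise_def linear_sum linear_cmul)
    then show ?thesis
      by (simp add: partial_deriv_eq_derivative[OF assms[OF that]] inner_sum_left mult.commute)
  qed
  then show ?thesis
    by (simp add: derivation_wrt_def euclidean_eq_iff[of "coordwise d _"] coordwise_inner_Basis)
qed

lemma differentiable_on_imp_frechet_derivative:
  assumes "h differentiable_on S" "open T" "T \<subseteq> S" "x \<in> T"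
  shows "(h has_derivative frechet_derivative h (at x)) (at x)"
  using assms differentiable_on_subset differentiable_on_eq_differentiable_at
    frechet_derivative_works by blast

text \<open>
  Both sides of the functional equation are differentiable functions of \<open>(x, y)\<close> that agree near
  the given point, so their derivatives agree.
\<close>

lemma derivative_of_addition_formula:
  assumes "open S" "open T" "x \<in> S" "y \<in> T"
    and eq: "\<And>x y. x \<in> S \<Longrightarrow> y \<in> T \<Longrightarrow> f (x + y) = g (f x, f y)"
    and fx: "(f has_derivative A) (at x)" and fy: "(f has_derivative B) (at y)"
    and fxy: "(f has_derivative C) (at (x + y))"
    and g: "(g has_derivative G) (at (f x, f y))"
  shows "C (a + b) = G (A a, B b)"
proof -
  have "((\<lambda>p. (f (fst p), f (snd p))) has_derivative (\<lambda>p. (A (fst p), B (snd p)))) (at (x, y))"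
    by (intro has_derivative_Pair
      has_derivative_compose[of fst fst "(x, y)" UNIV f A]
      has_derivative_compose[of snd snd "(x, y)" UNIV f B])
      (use fx fy in \<open>auto intro!: derivative_eq_intros\<close>)
  then have "((\<lambda>p. g (f (fst p), f (snd p))) has_derivative (\<lambda>p. G (A (fst p), B (snd p)))) (at (x, y))"
    by (rule has_derivative_compose) (use g in simp)
  moreover have "open (S \<times> T)" "(x, y) \<in> S \<times> T"
    using assms by (auto intro: open_Times)
  ultimately have "((\<lambda>p. f (fst p + snd p)) has_derivative (\<lambda>p. G (A (fst p), B (snd p)))) (at (x, y))"
    by (rule has_derivative_transform_within_open) (auto simp: eq)
  moreover have "((\<lambda>p. fst p + snd p) has_derivative (\<lambda>p. fst p + snd p)) (at (x, y))"
    by (auto intro!: derivative_eq_intros)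
  then have "((\<lambda>p. f (fst p + snd p)) has_derivative (\<lambda>p. C (fst p + snd p))) (at (x, y))"
    by (rule has_derivative_compose) (use fxy in simp)
  ultimately have "(\<lambda>p. G (A (fst p), B (snd p))) = (\<lambda>p. C (fst p + snd p))"
    by (rule has_derivative_unique)
  from fun_cong[OF this, of "(a, b)"] show ?thesis
    by simp
qed

theorem corollary2:
  fixes \<Omega>\<^sub>1 \<Omega>\<^sub>2 :: "(real ^ 'n) set"
    and f :: "real ^ 'n \<Rightarrow> real ^ 'm"
    and g :: "(real ^ 'm) \<times> (real ^ 'm) \<Rightarrow> real ^ 'm"
    and d :: "real \<Rightarrow> real"
  assumes "open \<Omega>\<^sub>1" and "\<Omega>\<^sub>1 \<noteq> {}"
    and "open \<Omega>\<^sub>2" and "\<Omega>\<^sub>2 \<noteq> {}"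
    and "f differentiable_on (\<Omega>\<^sub>1 \<union> \<Omega>\<^sub>2 \<union> (\<Omega>\<^sub>1 + \<Omega>\<^sub>2))"
    and "open (f ` \<Omega>\<^sub>1)" and "open (f ` \<Omega>\<^sub>2)"
    and "g differentiable_on (f ` \<Omega>\<^sub>1 \<times> f ` \<Omega>\<^sub>2)"
    and "\<And>x y. x \<in> \<Omega>\<^sub>1 \<Longrightarrow> y \<in> \<Omega>\<^sub>2 \<Longrightarrow> f (x + y) = g (f x, f y)"
    and "Modules.additive d"
    and "derivation_wrt d f (\<Omega>\<^sub>1 \<union> \<Omega>\<^sub>2 \<union> (\<Omega>\<^sub>1 + \<Omega>\<^sub>2))"
  shows "derivation_wrt d g (f ` \<Omega>\<^sub>1 \<times> f ` \<Omega>\<^sub>2)"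
proof -
  define \<Omega> where "\<Omega> = \<Omega>\<^sub>1 \<union> \<Omega>\<^sub>2 \<union> (\<Omega>\<^sub>1 + \<Omega>\<^sub>2)"
  define P where "P = f ` \<Omega>\<^sub>1 \<times> f ` \<Omega>\<^sub>2"
  have "\<Omega>\<^sub>1 + \<Omega>\<^sub>2 = (\<Union>x\<in>\<Omega>\<^sub>1. \<Union>y\<in>\<Omega>\<^sub>2. {x + y})"
    by (auto simp: set_plus_def)
  then have "open (\<Omega>\<^sub>1 + \<Omega>\<^sub>2)"
    using open_sums[of \<Omega>\<^sub>1 \<Omega>\<^sub>2] assms(1) by simp
  then have "open \<Omega>"
    using assms(1,3) by (auto simp: \<Omega>_def)
  then have f': "(f has_derivative frechet_derivative f (at x)) (at x)" if "x \<in> \<Omega>" for x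
    using that assms(5) differentiable_on_imp_frechet_derivative unfolding \<Omega>_def by blast
  have "open P"
    using assms(6,7) by (auto simp: P_def intro: open_Times)
  then have g': "(g has_derivative frechet_derivative g (at p)) (at p)" if "p \<in> P" for p
    using that assms(8) differentiable_on_imp_frechet_derivative unfolding P_def by blast
  have f_deriv: "coordwise d (f x) = frechet_derivative f (at x) (coordwise d x)" if "x \<in> \<Omega>" for x
    using assms(11) that derivation_wrt_iff_coordwise[OF f'] unfolding \<Omega>_def by blast
  have "coordwise d (g p) = frechet_derivative g (at p) (coordwise d p)" if p_in: "p \<in> P" for p
  proof -
    obtain x y where x: "x \<in> \<Omega>\<^sub>1" and y: "y \<in> \<Omega>\<^sub>2" and p: "p = (f x, f y)"
      using p_in by (auto simp: P_def)
    have mem: "x \<in> \<Omega>" "y \<in> \<Omega>" "x + y \<in> \<Omega>"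
      using x y by (auto simp: \<Omega>_def)
    have "coordwise d (g p) = coordwise d (f (x + y))"
      using assms(9) x y p by simp
    also have "\<dots> = frechet_derivative f (at (x + y)) (coordwise d x + coordwise d y)"
      by (simp add: f_deriv mem coordwise_add[OF assms(10)])
    also have "\<dots> = frechet_derivative g (at p)
        (frechet_derivative f (at x) (coordwise d x), frechet_derivative f (at y) (coordwise d y))"
      by (rule derivative_of_addition_formula[where f = f and g = g, OF assms(1,3) x y assms(9)])
        (use f' mem g' p_in p in auto)
    also have "\<dots> = frechet_derivative g (at p) (coordwise d p)"
      by (simp add: p coordwise_Pair f_deriv mem)
    finally show ?thesis .
  qed
  then show ?thesis
    using derivation_wrt_iff_coordwise[OF g'] unfolding P_def by blast
qed

end
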